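(* For any $2$-regular graph $G$ with $n$ vertices, we have $$\frac{n-3}{6} \;\leq\; u(G) \;\leq\; \frac{n}{4}.$$
   Context: Graphs are finite and simple (so a $2$-regular graph is a union of disjoint cycles). The Toucher-Isolator game on a graph $G=(V(G),E(G))$: two players, Toucher and Isolator, alternately claim previously unclaimed edges of $G$, one edge per move, with Toucher making the first move, until all edges are claimed. A vertex is touched if it is incident to at least one edge claimed by Toucher, and untouched otherwise (i.e. all of its incident edges have been claimed by Isolator). Toucher aims to minimise, and Isolator to maximise, the number of untouched vertices at the end of the game. $u(G)$ denotes the number of untouched vertices at the end of the game when both players play optimally (the minimax value of this game). *)

theory Defs
  imports Complex_Main
begin

definition simple_graph :: "'a set \<Rightarrow> 'a set set \<Rightarrow> bool" where
  "simple_graph V E \<longleftrightarrow> finite V \<and> (\<forall>e\<in>E. e \<subseteq> V \<and> card e = 2)"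

definition vertex_degree :: "'a set set \<Rightarrow> 'a \<Rightarrow> nat" where
  "vertex_degree E v = card {e \<in> E. v \<in> e}"

definition regular_graph :: "nat \<Rightarrow> 'a set \<Rightarrow> 'a set set \<Rightarrow> bool" where
  "regular_graph k V E \<longleftrightarrow> simple_graph V E \<and> (\<forall>v\<in>V. vertex_degree E v = k)"

definition touched :: "'a set set \<Rightarrow> 'a \<Rightarrow> bool" where
  "touched T v \<longleftrightarrow> (\<exists>e\<in>T. v \<in> e)"

datatype player = Toucher | Isolator

text \<open>
  \<open>game_value V E p T I\<close> is the number of untouched vertices at the end of the game, under
  optimal play, from the position in which Toucher has claimed the edges \<open>T\<close>, Isolator has
  claimed the edges \<open>I\<close>, and \<open>p\<close> is to move. The case of infinite \<open>E\<close> only serves to make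
  the function total.
\<close>

function game_value ::
  "'a set \<Rightarrow> 'a set set \<Rightarrow> player \<Rightarrow> 'a set set \<Rightarrow> 'a set set \<Rightarrow> nat" where
  "game_value V E p T I =
    (if infinite E \<or> E - (T \<union> I) = {} then card {v \<in> V. \<not> touched T v}
     else case p of
        Toucher \<Rightarrow> Min ((\<lambda>e. game_value V E Isolator (insert e T) I) ` (E - (T \<union> I)))
      | Isolator \<Rightarrow> Max ((\<lambda>e. game_value V E Toucher T (insert e I)) ` (E - (T \<union> I))))"
  by pat_completeness auto
termination
proof (relation "Wellfounded.measure (\<lambda>(V, E, p, T, I). card (E - (T \<union> I)))", goal_cases)
  case 1
  show ?case by simp
next
  case (2 V E p T I e)
  then have "card (E - (insert e T \<union> I)) < card (E - (T \<union> I))"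
    by (intro psubset_card_mono) auto
  then show ?case by simp
next
  case (3 V E p T I e)
  then have "card (E - (T \<union> insert e I)) < card (E - (T \<union> I))"
    by (intro psubset_card_mono) auto
  then show ?case by simp
qed

declare game_value.simps [simp del]

definition untouched_number :: "'a set \<Rightarrow> 'a set set \<Rightarrow> nat" where
  "untouched_number V E = game_value V E Toucher {} {}"

end

theory Submission
  imports Defs
begin

text \<open>
  Both bounds come from a potential that is a sum of local terms and that one of the players can
  keep from moving in the wrong direction over each pair of consecutive moves.

  For the upper bound, give an untouched vertex with \<open>r\<close> unclaimed edges the weight \<open>2\<^sup>-\<^sup>r\<close>, the
  probability that it stays untouched if the unclaimed edges are distributed by fair coins.
  Toucher claims the edge whose endpoints have the largest total weight, and this weight is lost.
  Isolator's reply adds at most the weight of the endpoints of his edge, which was no larger. So the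
  total weight never exceeds its initial value \<open>n / 4\<close>, and at the end it counts the untouched
  vertices (\<open>game_value_le_total_weight\<close>). The same argument bounds the number of untouched vertices
  of any finite graph by the sum of \<open>2\<^sup>-\<^sup>d\<close> over the vertex degrees \<open>d\<close>.

  For the lower bound, view the game on the line graph, again a union of disjoint cycles: every
  edge has two neighbours, and a vertex stays untouched if its two edges, which are neighbours, both
  go to Isolator. The potential is six times the number of vertices already isolated, plus for each
  unclaimed edge a weight that depends on its two neighbours only: 4 if both are Isolator's, 3 if
  exactly one is, and otherwise 0 or 1 according to whether Toucher owns a neighbour or not. It
  starts at \<open>n\<close>, and Toucher's first move costs 3. From then on Isolator, replying to Toucher, keeps
  it at \<open>n - 3\<close> or above (\<open>sound_move_exists\<close>), up to one kind of position treated below; at the end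
  the potential is six times the number of untouched vertices, so \<open>6 u \<ge> n - 3\<close>.

  The weights are calibrated on disjoint triangles, where opening a triangle should be worth 3 to
  either player. In general Toucher can never destroy more than 4, and a loss of 4 occurs only
  beside an edge of Isolator. If Isolator can gain 4 he does so and is safe. Otherwise every
  unclaimed edge beside one of his also lies beside one of Toucher's (\<open>quiet\<close>). If he then has a
  move that gains 3 and keeps the position quiet, he is safe as well, because in a quiet position
  Toucher can destroy no more than 3. Neither kind of move need exist when every unclaimed edge has
  both neighbours unclaimed or both neighbours Toucher's. Then Isolator opens a cycle, if one
  remains, gaining 3, and Toucher may answer with a loss of 4; but then Isolator can extend his edge
  on the other side for a gain of at least 5. A deficit of one is therefore tolerated when such a
  move is at hand (\<open>good\<close>).
\<close>

section \<open>One move of the game\<close>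

lemma game_value_final:
  assumes "E \<subseteq> T \<union> I"
  shows "game_value V E p T I = card {v \<in> V. \<not> touched T v}"
  using assms by (subst game_value.simps) auto

lemma game_value_Toucher:
  assumes "finite E" "E - (T \<union> I) \<noteq> {}"
  shows "game_value V E Toucher T I =
    Min ((\<lambda>e. game_value V E Isolator (insert e T) I) ` (E - (T \<union> I)))"
  using assms by (subst game_value.simps) auto

lemma game_value_Isolator:
  assumes "finite E" "E - (T \<union> I) \<noteq> {}"
  shows "game_value V E Isolator T I =
    Max ((\<lambda>e. game_value V E Toucher T (insert e I)) ` (E - (T \<union> I)))"
  using assms by (subst game_value.simps) auto

lemma game_value_Toucher_le:
  assumes "finite E" "e \<in> E - (T \<union> I)"
  shows "game_value V E Toucher T I \<le> game_value V E Isolator (insert e T) I"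
proof -
  have "E - (T \<union> I) \<noteq> {}" using assms by blast
  with assms show ?thesis
    by (subst game_value_Toucher) (auto intro!: Min_le)
qed

lemma game_value_Isolator_ge:
  assumes "finite E" "e \<in> E - (T \<union> I)"
  shows "game_value V E Toucher T (insert e I) \<le> game_value V E Isolator T I"
proof -
  have "E - (T \<union> I) \<noteq> {}" using assms by blast
  with assms show ?thesis
    by (subst game_value_Isolator) (auto intro!: Max_ge)
qed

lemma game_value_Toucher_attained:
  assumes "finite E" "E - (T \<union> I) \<noteq> {}"
  obtains e where "e \<in> E - (T \<union> I)"
    "game_value V E Toucher T I = game_value V E Isolator (insert e T) I"
proof -
  have "Min ((\<lambda>e. game_value V E Isolator (insert e T) I) ` (E - (T \<union> I)))
      \<in> (\<lambda>e. game_value V E Isolator (insert e T) I) ` (E - (T \<union> I))"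
    using assms by (intro Min_in) auto
  then show ?thesis
    using that game_value_Toucher[OF assms] by force
qed

lemma game_value_Isolator_attained:
  assumes "finite E" "E - (T \<union> I) \<noteq> {}"
  obtains e where "e \<in> E - (T \<union> I)"
    "game_value V E Isolator T I = game_value V E Toucher T (insert e I)"
proof -
  have "Max ((\<lambda>e. game_value V E Toucher T (insert e I)) ` (E - (T \<union> I)))
      \<in> (\<lambda>e. game_value V E Toucher T (insert e I)) ` (E - (T \<union> I))"
    using assms by (intro Max_in) auto
  then show ?thesis
    using that game_value_Isolator[OF assms] by force
qed

section \<open>Toucher's strategy: the upper bound\<close>

text \<open>
  The probability that \<open>v\<close> stays untouched when each unclaimed edge goes to either player with
  probability one half.
\<close>

definition vertex_weight :: "'a set set \<Rightarrow> 'a set set \<Rightarrow> 'a set set \<Rightarrow> 'a \<Rightarrow> real" where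
  "vertex_weight E T I v =
    (if touched T v then 0 else (1 / 2) ^ card {e \<in> E - (T \<union> I). v \<in> e})"

definition edge_weight :: "'a set \<Rightarrow> 'a set set \<Rightarrow> 'a set set \<Rightarrow> 'a set set \<Rightarrow> 'a set \<Rightarrow> real" where
  "edge_weight V E T I e = (\<Sum>v \<in> {v \<in> V. v \<in> e}. vertex_weight E T I v)"

lemma vertex_weight_Toucher:
  assumes "e \<in> E - (T \<union> I)"
  shows "vertex_weight E (insert e T) I v = (if v \<in> e then 0 else vertex_weight E T I v)"
proof (cases "v \<in> e")
  case False
  then have "{f \<in> E - (insert e T \<union> I). v \<in> f} = {f \<in> E - (T \<union> I). v \<in> f}" by auto
  then show ?thesis using False by (auto simp: vertex_weight_def touched_def)
qed (auto simp: vertex_weight_def touched_def)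

lemma vertex_weight_Isolator:
  assumes "finite E" "e \<in> E - (T \<union> I)"
  shows "vertex_weight E T (insert e I) v =
    vertex_weight E T I v + (if v \<in> e then vertex_weight E T I v else 0)"
proof (cases "v \<in> e")
  case True
  let ?A = "{f \<in> E - (T \<union> I). v \<in> f}"
  have "{f \<in> E - (T \<union> insert e I). v \<in> f} = ?A - {e}" by auto
  moreover have "card ?A = Suc (card (?A - {e}))"
    using assms True by (intro card.remove) auto
  ultimately show ?thesis using True by (auto simp: vertex_weight_def)
next
  case False
  then have "{f \<in> E - (T \<union> insert e I). v \<in> f} = {f \<in> E - (T \<union> I). v \<in> f}" by auto
  then show ?thesis using False by (simp add: vertex_weight_def)
qed

text \<open>
  A move of Toucher on \<open>e\<close> and a move of Isolator on \<open>e\<close> change the total weight by the same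
  amount in opposite directions, since the weight of an endpoint is the mean of the values 0 and
  \<open>2 w\<close> that it can take next. This is what makes the greedy choice good enough.
\<close>

lemma total_weight_Toucher:
  assumes "finite V" "e \<in> E - (T \<union> I)"
  shows "(\<Sum>v\<in>V. vertex_weight E (insert e T) I v) =
    (\<Sum>v\<in>V. vertex_weight E T I v) - edge_weight V E T I e"
proof -
  have "(\<Sum>v\<in>V. vertex_weight E (insert e T) I v) =
      (\<Sum>v\<in>V. vertex_weight E T I v - (if v \<in> e then vertex_weight E T I v else 0))"
    using assms(2) by (intro sum.cong) (auto simp: vertex_weight_Toucher)
  then show ?thesis
    by (simp add: sum_subtractf edge_weight_def sum.inter_filter[OF assms(1)])
qed

lemma total_weight_Isolator:
  assumes "finite V" "finite E" "e \<in> E - (T \<union> I)"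
  shows "(\<Sum>v\<in>V. vertex_weight E T (insert e I) v) =
    (\<Sum>v\<in>V. vertex_weight E T I v) + edge_weight V E T I e"
  by (simp add: vertex_weight_Isolator[OF assms(2,3)] sum.distrib edge_weight_def
      sum.inter_filter[OF assms(1)])

lemma vertex_weight_nonneg: "0 \<le> vertex_weight E T I v"
  by (simp add: vertex_weight_def)

lemma total_weight_final:
  assumes "finite V" "E \<subseteq> T \<union> I"
  shows "(\<Sum>v\<in>V. vertex_weight E T I v) = real (card {v \<in> V. \<not> touched T v})"
proof -
  have "E - (T \<union> I) = {}" using assms by blast
  then have no_free: "{e \<in> E - (T \<union> I). v \<in> e} = {}" for v by blast
  have "(\<Sum>v\<in>V. vertex_weight E T I v) = (\<Sum>v\<in>V. if \<not> touched T v then 1 else 0)"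
    unfolding vertex_weight_def no_free by (intro sum.cong) simp_all
  then show ?thesis
    by (simp add: sum.inter_filter[OF assms(1), symmetric])
qed

text \<open>
  Toucher plays an edge of maximal weight. Her move cannot raise the weight of the edge that
  Isolator claims next, so he regains at most what she removed.
\<close>

lemma game_value_le_total_weight:
  assumes "finite V" "finite E"
  shows "real (game_value V E Toucher T I) \<le> (\<Sum>v\<in>V. vertex_weight E T I v)"
proof (induction "card (E - (T \<union> I))" arbitrary: T I rule: less_induct)
  case less
  show ?case
  proof (cases "E \<subseteq> T \<union> I")
    case True
    then show ?thesis using assms by (simp add: game_value_final total_weight_final)
  next
    case False
    let ?F = "E - (T \<union> I)"
    have ne: "?F \<noteq> {}" using False by blast
    have fin: "finite ?F" using assms by simp
    obtain e where e: "e \<in> ?F"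
      and e_max: "\<And>f. f \<in> ?F \<Longrightarrow> edge_weight V E T I f \<le> edge_weight V E T I e"
    proof -
      have "Max (edge_weight V E T I ` ?F) \<in> edge_weight V E T I ` ?F"
        using fin ne by (intro Max_in) auto
      then obtain e where "e \<in> ?F" "Max (edge_weight V E T I ` ?F) = edge_weight V E T I e"
        by blast
      then show thesis using fin by (intro that[of e]) (auto simp flip: \<open>Max _ = _\<close>)
    qed
    have after_e: "(\<Sum>v\<in>V. vertex_weight E (insert e T) I v) =
        (\<Sum>v\<in>V. vertex_weight E T I v) - edge_weight V E T I e"
      using assms e by (intro total_weight_Toucher)
    have "real (game_value V E Isolator (insert e T) I) \<le> (\<Sum>v\<in>V. vertex_weight E T I v)"
    proof (cases "E \<subseteq> insert e T \<union> I")
      case True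
      have "0 \<le> edge_weight V E T I e"
        by (auto simp: edge_weight_def intro!: sum_nonneg vertex_weight_nonneg)
      then show ?thesis
        using True assms after_e by (simp add: game_value_final total_weight_final)
    next
      case False
      then have "E - (insert e T \<union> I) \<noteq> {}" by blast
      then obtain f where f: "f \<in> E - (insert e T \<union> I)"
        and val: "game_value V E Isolator (insert e T) I
          = game_value V E Toucher (insert e T) (insert f I)"
        using game_value_Isolator_attained assms(2) by metis
      \<comment> \<open>if \<open>f\<close> shares an endpoint with \<open>e\<close>, that endpoint is now worthless\<close>
      have "edge_weight V E (insert e T) I f \<le> edge_weight V E T I f"
        unfolding edge_weight_def
        using e by (intro sum_mono) (auto simp: vertex_weight_Toucher vertex_weight_nonneg)
      also have "\<dots> \<le> edge_weight V E T I e" using f by (intro e_max) auto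
      finally have le: "edge_weight V E (insert e T) I f \<le> edge_weight V E T I e" .
      have "card (E - (insert e T \<union> insert f I)) < card ?F"
        using e fin by (intro psubset_card_mono) auto
      then have "real (game_value V E Toucher (insert e T) (insert f I))
          \<le> (\<Sum>v\<in>V. vertex_weight E (insert e T) (insert f I) v)"
        by (rule less)
      also have "\<dots> = (\<Sum>v\<in>V. vertex_weight E (insert e T) I v)
          + edge_weight V E (insert e T) I f"
        using assms f by (intro total_weight_Isolator)
      finally show ?thesis using val after_e le by simp
    qed
    then show ?thesis
      using game_value_Toucher_le[OF assms(2) e, of V] by linarith
  qed
qed

theorem untouched_number_le:
  assumes "finite V" "finite E"
  shows "real (untouched_number V E) \<le> (\<Sum>v\<in>V. (1 / 2) ^ vertex_degree E v)"
  using game_value_le_total_weight[OF assms, of "{}" "{}"]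
  by (simp add: untouched_number_def vertex_weight_def touched_def vertex_degree_def)

section \<open>Neighbouring edges in a 2-regular graph\<close>

locale two_regular_graph =
  fixes V :: "'a set" and E :: "'a set set"
  assumes two_regular: "regular_graph 2 V E"
begin

lemma finite_V: "finite V"
  using two_regular by (simp add: regular_graph_def simple_graph_def)

lemma edgeD: "e \<in> E \<Longrightarrow> e \<subseteq> V \<and> card e = 2"
  using two_regular by (simp add: regular_graph_def simple_graph_def)

lemma finite_E: "finite E"
  using finite_V edgeD by (meson Pow_iff finite_Pow_iff finite_subset subsetI)

lemma card_edges_at: "v \<in> V \<Longrightarrow> card {e \<in> E. v \<in> e} = 2"
  using two_regular by (simp add: regular_graph_def vertex_degree_def)

lemma card_E_eq_card_V: "card E = card V"
proof -
  have "2 * card V = (\<Sum>v\<in>V. card {e \<in> E. v \<in> e})"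
    by (simp add: card_edges_at)
  also have "\<dots> = (\<Sum>v\<in>V. \<Sum>e\<in>E. if v \<in> e then 1 else 0)"
    by (simp add: sum.inter_filter[OF finite_E, symmetric])
  also have "\<dots> = (\<Sum>e\<in>E. \<Sum>v\<in>V. if v \<in> e then 1 else 0)"
    by (rule sum.swap)
  also have "\<dots> = (\<Sum>e\<in>E. card {v \<in> V. v \<in> e})"
    by (simp add: sum.inter_filter[OF finite_V, symmetric])
  also have "\<dots> = (\<Sum>e\<in>E. 2)"
  proof (rule sum.cong)
    fix e assume "e \<in> E"
    then have "{v \<in> V. v \<in> e} = e" "card e = 2" using edgeD by auto
    then show "card {v \<in> V. v \<in> e} = 2" by simp
  qed simp
  finally show ?thesis by simp
qed

definition nbrs :: "'a set \<Rightarrow> 'a set set" where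
  "nbrs e = {f \<in> E. f \<noteq> e \<and> f \<inter> e \<noteq> {}}"

lemma other_edge_at:
  assumes "v \<in> V" "e \<in> E" "v \<in> e"
  obtains a where "a \<noteq> e" "{f \<in> E. v \<in> f} = {e, a}"
proof -
  obtain p q where "{f \<in> E. v \<in> f} = {p, q}" "p \<noteq> q"
    using card_edges_at[OF assms(1)] by (meson card_2_iff)
  moreover have "e \<in> {f \<in> E. v \<in> f}" using assms by simp
  ultimately show ?thesis
    using that[of p] that[of q] by (cases "p = e") (auto simp: insert_commute)
qed

text \<open>
  The neighbours of \<open>e\<close> at its two endpoints are distinct: an edge containing both
  endpoints would be \<open>e\<close> itself, as there are no parallel edges. This makes the line graph
  2-regular too, and each vertex corresponds to exactly one pair of neighbouring edges.
\<close>

lemma edge_structure: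
  assumes "e \<in> E"
  obtains u v a b where "e = {u, v}" "u \<noteq> v" "u \<in> V" "v \<in> V" "a \<noteq> b" "a \<noteq> e" "b \<noteq> e"
    "nbrs e = {a, b}" "{f \<in> E. u \<in> f} = {e, a}" "{f \<in> E. v \<in> f} = {e, b}"
proof -
  obtain u v where uv: "e = {u, v}" "u \<noteq> v" using edgeD[OF assms] by (meson card_2_iff)
  then have V: "u \<in> V" "v \<in> V" using edgeD[OF assms] by auto
  obtain a where a: "a \<noteq> e" "{f \<in> E. u \<in> f} = {e, a}"
    using other_edge_at[OF V(1) assms] uv by auto
  obtain b where b: "b \<noteq> e" "{f \<in> E. v \<in> f} = {e, b}"
    using other_edge_at[OF V(2) assms] uv by auto
  have aE: "a \<in> E" "u \<in> a" and bE: "b \<in> E" "v \<in> b" using a b by blast+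
  have "a \<noteq> b"
  proof
    assume "a = b"
    then have "{u, v} \<subseteq> a" using aE bE by auto
    moreover have "card a = 2" "finite a" using edgeD[OF aE(1)] by (auto intro: card_ge_0_finite)
    ultimately have "{u, v} = a" using uv by (intro card_subset_eq) auto
    then show False using a uv by simp
  qed
  moreover have "nbrs e = ({f \<in> E. u \<in> f} \<union> {f \<in> E. v \<in> f}) - {e}"
    unfolding nbrs_def uv by blast
  then have "nbrs e = {a, b}" using a b by auto
  ultimately show ?thesis by (intro that[OF uv V]) (use a b in auto)
qed

lemma nbrs_pair:
  assumes "e \<in> E"
  shows "\<exists>a b. a \<noteq> b \<and> nbrs e = {a, b}"
proof (rule edge_structure[OF assms])
  fix a b assume "a \<noteq> b" "nbrs e = {a, b}"
  then show ?thesis by blast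
qed

lemma nbrsD:
  assumes "f \<in> nbrs e" shows "f \<in> E" "f \<noteq> e"
  using assms by (auto simp: nbrs_def)

lemma nbrs_sym: "e \<in> E \<Longrightarrow> f \<in> nbrs e \<Longrightarrow> e \<in> nbrs f"
  by (auto simp: nbrs_def)

lemma other_nbr:
  assumes "e \<in> E" "a \<in> nbrs e"
  shows "\<exists>b. b \<noteq> a \<and> nbrs e = {a, b}"
proof -
  obtain p q where "p \<noteq> q" "nbrs e = {p, q}" using nbrs_pair[OF assms(1)] by blast
  then show ?thesis using assms(2) by (cases "a = p") auto
qed

lemma nbrs_nonempty: "e \<in> E \<Longrightarrow> \<exists>a. a \<in> nbrs e"
  using nbrs_pair by blast

lemma finite_nbrs: "finite (nbrs e)"
  using finite_E by (simp add: nbrs_def)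

section \<open>The potential for Isolator's strategy\<close>

definition isolated :: "'a set set \<Rightarrow> 'a set" where
  "isolated I = {v \<in> V. \<forall>e\<in>E. v \<in> e \<longrightarrow> e \<in> I}"

lemma card_isolated_insert:
  assumes "x \<in> E - I"
  shows "card (isolated (insert x I)) = card (isolated I) + card (nbrs x \<inter> I)"
proof -
  have xE: "x \<in> E" using assms by simp
  obtain u v a b where s: "x = {u, v}" "u \<noteq> v" "u \<in> V" "v \<in> V" "a \<noteq> b" "a \<noteq> x" "b \<noteq> x"
    "nbrs x = {a, b}" "{f \<in> E. u \<in> f} = {x, a}" "{f \<in> E. v \<in> f} = {x, b}"
    by (rule edge_structure[OF xE])
  let ?U = "(if a \<in> I then {u} else {}) \<union> (if b \<in> I then {v} else {})"
  have u: "e \<in> E \<and> u \<in> e \<longleftrightarrow> e = x \<or> e = a" for e using s(9) by blast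
  have v: "e \<in> E \<and> v \<in> e \<longleftrightarrow> e = x \<or> e = b" for e using s(10) by blast
  have iu: "u \<in> isolated (insert x I) \<longleftrightarrow> a \<in> I"
    using s(3,6) u by (auto simp: isolated_def)
  have iv: "v \<in> isolated (insert x I) \<longleftrightarrow> b \<in> I"
    using s(4,7) v by (auto simp: isolated_def)
  have n: "u \<notin> isolated I" "v \<notin> isolated I"
    using u v assms by (auto simp: isolated_def)
  have other: "w \<in> isolated (insert x I) \<longleftrightarrow> w \<in> isolated I" if "w \<noteq> u" "w \<noteq> v" for w
    using that s(1) by (auto simp: isolated_def)
  have "w \<in> isolated (insert x I) \<longleftrightarrow> w \<in> isolated I \<union> ?U" for w
    using iu iv n other[of w] s(2) by (cases "w = u"; cases "w = v") auto
  then have "isolated (insert x I) = isolated I \<union> ?U" by blast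
  moreover have "finite (isolated I)" using finite_V by (simp add: isolated_def)
  moreover have "card ?U = card (nbrs x \<inter> I)" using s(2,5,8) by auto
  moreover have "isolated I \<inter> ?U = {}" using n by auto
  ultimately show ?thesis by (simp add: card_Un_disjoint)
qed

text \<open>
  The cases were found by looking at runs of consecutive unclaimed edges. A run of length
  \<open>L \<ge> 2\<close> has total weight \<open>L - 2\<close> between two edges of Toucher, \<open>L + 1\<close> between edges of
  different players, and \<open>L + 4\<close> between two edges of Isolator; an unclaimed cycle of length \<open>L\<close>
  has weight \<open>L\<close>. Opening a cycle thus changes the potential by 3 whoever moves.
\<close>

definition weight :: "'a set set \<Rightarrow> 'a set set \<Rightarrow> 'a set \<Rightarrow> int" where
  "weight T I e = (if nbrs e \<subseteq> I then 4 else if nbrs e \<inter> I \<noteq> {} then 3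
    else if nbrs e \<inter> T \<noteq> {} then 0 else 1)"

definition potential :: "'a set set \<Rightarrow> 'a set set \<Rightarrow> int" where
  "potential T I = 6 * int (card (isolated I)) + (\<Sum>e \<in> E - (T \<union> I). weight T I e)"

definition legal :: "'a set set \<Rightarrow> 'a set set \<Rightarrow> bool" where
  "legal T I \<longleftrightarrow> T \<subseteq> E \<and> T \<inter> I = {}"

definition fresh :: "'a set set \<Rightarrow> 'a set set \<Rightarrow> 'a set \<Rightarrow> bool" where
  "fresh T I y \<longleftrightarrow> y \<notin> T \<union> I \<and> nbrs y \<inter> (T \<union> I) = {}"

text \<open>
  The contribution of a neighbour \<open>y\<close> of \<open>x\<close> to Isolator's gain when he claims \<open>x\<close>: 6 if their
  common vertex becomes isolated, and the increase of the weight of \<open>y\<close> if \<open>y\<close> is unclaimed.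
\<close>

definition bonus :: "'a set set \<Rightarrow> 'a set set \<Rightarrow> 'a set \<Rightarrow> int" where
  "bonus T I y = (if y \<in> I then 6 else if y \<in> T then 0
    else if nbrs y \<inter> I \<noteq> {} then 1 else if nbrs y \<inter> T \<noteq> {} then 3 else 2)"

text \<open>
  Claiming \<open>x\<close> affects only the weights of its neighbours, so the change of a sum over the
  unclaimed edges reduces to a sum over \<open>nbrs x\<close>.
\<close>

lemma sum_over_nbrs:
  fixes g :: "'a set \<Rightarrow> int"
  assumes "F \<subseteq> E" "x \<in> F" "\<And>y. y \<in> F - {x} \<Longrightarrow> y \<notin> nbrs x \<Longrightarrow> h y = g y"
  shows "sum h (F - {x}) = sum g F - g x + (\<Sum>y\<in>nbrs x. if y \<in> F then h y - g y else 0)"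
proof -
  have fin: "finite F" using assms(1) finite_E finite_subset by blast
  have "sum h (F - {x}) - sum g (F - {x}) = (\<Sum>y\<in>F - {x}. h y - g y)"
    by (simp add: sum_subtractf)
  also have "\<dots> = (\<Sum>y\<in>nbrs x \<inter> F. h y - g y)"
    using fin assms(3) nbrsD(2) by (intro sum.mono_neutral_right) auto
  also have "\<dots> = (\<Sum>y\<in>nbrs x. if y \<in> F then h y - g y else 0)"
    by (rule sum.inter_restrict[OF finite_nbrs])
  finally show ?thesis using sum.remove[OF fin assms(2), of g] by simp
qed

lemma potential_Toucher:
  assumes "x \<in> E - (T \<union> I)"
  shows "potential (insert x T) I =
    potential T I - weight T I x - (\<Sum>y\<in>nbrs x. of_bool (fresh T I y))"
proof -
  let ?F = "E - (T \<union> I)"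
  have "E - (insert x T \<union> I) = ?F - {x}" by auto
  moreover have "sum (weight (insert x T) I) (?F - {x}) = sum (weight T I) ?F - weight T I x
      + (\<Sum>y\<in>nbrs x. if y \<in> ?F then weight (insert x T) I y - weight T I y else 0)"
  proof (rule sum_over_nbrs)
    fix y assume y: "y \<in> ?F - {x}" "y \<notin> nbrs x"
    then have "x \<notin> nbrs y" using nbrs_sym by blast
    then show "weight (insert x T) I y = weight T I y" by (auto simp: weight_def)
  qed (use assms in auto)
  moreover have "(\<Sum>y\<in>nbrs x. if y \<in> ?F then weight (insert x T) I y - weight T I y else 0)
      = (\<Sum>y\<in>nbrs x. - of_bool (fresh T I y))"
  proof (rule sum.cong)
    fix y assume y: "y \<in> nbrs x"
    then have "y \<in> E" "x \<in> nbrs y" using assms nbrs_sym nbrsD(1)[OF y] by auto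
    then show "(if y \<in> ?F then weight (insert x T) I y - weight T I y else 0)
        = - of_bool (fresh T I y)"
      using assms by (auto simp: weight_def fresh_def)
  qed simp
  ultimately show ?thesis by (simp add: potential_def sum_negf)
qed

lemma potential_Isolator:
  assumes "legal T I" "x \<in> E - (T \<union> I)"
  shows "potential T (insert x I) = potential T I - weight T I x + (\<Sum>y\<in>nbrs x. bonus T I y)"
proof -
  let ?F = "E - (T \<union> I)"
  have F: "E - (T \<union> insert x I) = ?F - {x}" by auto
  have "sum (weight T (insert x I)) (?F - {x}) = sum (weight T I) ?F - weight T I x
      + (\<Sum>y\<in>nbrs x. if y \<in> ?F then weight T (insert x I) y - weight T I y else 0)"
  proof (rule sum_over_nbrs)
    fix y assume y: "y \<in> ?F - {x}" "y \<notin> nbrs x"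
    then have "x \<notin> nbrs y" using nbrs_sym by blast
    then show "weight T (insert x I) y = weight T I y" by (auto simp: weight_def)
  qed (use assms in auto)
  moreover have "6 * int (card (isolated (insert x I)))
      = 6 * int (card (isolated I)) + (\<Sum>y\<in>nbrs x. if y \<in> I then 6 else 0)"
    using card_isolated_insert[of x I] assms(2)
    by (simp add: sum.inter_restrict[OF finite_nbrs, symmetric])
  moreover have "(\<Sum>y\<in>nbrs x. if y \<in> I then 6 else 0)
      + (\<Sum>y\<in>nbrs x. if y \<in> ?F then weight T (insert x I) y - weight T I y else 0)
      = (\<Sum>y\<in>nbrs x. bonus T I y)"
    unfolding sum.distrib[symmetric]
  proof (rule sum.cong)
    fix y assume y: "y \<in> nbrs x"
    then have yE: "y \<in> E" "x \<in> nbrs y" using assms nbrs_sym nbrsD(1)[OF y] by auto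
    then obtain c where c: "c \<noteq> x" "nbrs y = {x, c}" using other_nbr[of y x] by blast
    then show "(if y \<in> I then 6 else 0)
        + (if y \<in> ?F then weight T (insert x I) y - weight T I y else 0) = bonus T I y"
      using assms yE by (auto simp: weight_def bonus_def legal_def)
  qed simp
  ultimately show ?thesis unfolding potential_def F by linarith
qed

lemma potential_final:
  assumes "legal T I" "E \<subseteq> T \<union> I"
  shows "potential T I = 6 * int (card {v \<in> V. \<not> touched T v})"
proof -
  have "isolated I = {v \<in> V. \<not> touched T v}"
    using assms unfolding isolated_def touched_def legal_def by blast
  moreover have no_free: "E - (T \<union> I) = {}" using assms by blast
  ultimately show ?thesis by (simp add: potential_def no_free)
qed

lemma potential_initial: "potential {} {} = int (card V)"
proof -
  have "weight {} {} e = 1" if "e \<in> E" for e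
    using nbrs_nonempty[OF that] by (auto simp: weight_def)
  moreover have "isolated {} = {}"
  proof -
    have "\<exists>e\<in>E. v \<in> e" if "v \<in> V" for v
    proof (rule ccontr)
      assume "\<not> ?thesis"
      then have "{e \<in> E. v \<in> e} = {}" by blast
      then have "card {e \<in> E. v \<in> e} = 0" by (simp only: card.empty)
      then show False using card_edges_at[OF that] by linarith
    qed
    then show ?thesis by (auto simp: isolated_def)
  qed
  ultimately show ?thesis by (simp add: potential_def card_E_eq_card_V)
qed

section \<open>How much a single move changes the potential\<close>

text \<open>
  Besides \<open>x\<close> itself, Toucher's claim devalues only those neighbours of \<open>x\<close> that had no claimed
  neighbour, each of them from 1 to 0.
\<close>

lemma Toucher_loss:
  assumes "x \<in> E - (T \<union> I)"
  obtains a b where "nbrs x = {a, b}"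
    "potential T I - potential (insert x T) I \<le>
      weight T I x + of_bool (a \<notin> T \<union> I) + of_bool (b \<notin> T \<union> I)"
proof -
  obtain a b where ab: "a \<noteq> b" "nbrs x = {a, b}"
    using nbrs_pair[of x] assms by blast
  have "of_bool (fresh T I y) \<le> (of_bool (y \<notin> T \<union> I) :: int)" for y
    by (simp add: fresh_def)
  from this[of a] this[of b] show ?thesis
    using that[OF ab(2)] potential_Toucher[OF assms] ab(1) by (simp add: ab(2) del: sum_of_bool_eq)
qed

lemma Toucher_loss_le_4:
  assumes "x \<in> E - (T \<union> I)"
  shows "potential T I - 4 \<le> potential (insert x T) I"
proof -
  obtain a b where ab: "nbrs x = {a, b}" and loss: "potential T I - potential (insert x T) I \<le>
      weight T I x + of_bool (a \<notin> T \<union> I) + of_bool (b \<notin> T \<union> I)"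
    by (rule Toucher_loss[OF assms])
  have "weight T I x + of_bool (a \<notin> T \<union> I) + of_bool (b \<notin> T \<union> I) \<le> 4"
    by (cases "a \<in> I"; cases "b \<in> I") (simp_all add: ab weight_def)
  then show ?thesis using loss by linarith
qed

text \<open>
  A loss of 4 requires that \<open>x\<close> lie between two edges of Isolator, or between one of his edges
  and an unclaimed edge.
\<close>

lemma Toucher_loss_le_3:
  assumes "legal T I" "x \<in> E - (T \<union> I)" "nbrs x \<inter> I = {} \<or> nbrs x \<inter> T \<noteq> {}"
  shows "potential T I - 3 \<le> potential (insert x T) I"
proof -
  obtain a b where ab: "nbrs x = {a, b}" and loss: "potential T I - potential (insert x T) I \<le>
      weight T I x + of_bool (a \<notin> T \<union> I) + of_bool (b \<notin> T \<union> I)"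
    by (rule Toucher_loss[OF assms(2)])
  have disj: "y \<in> T \<Longrightarrow> y \<notin> I" for y using assms(1) by (auto simp: legal_def)
  have "weight T I x + of_bool (a \<notin> T \<union> I) + of_bool (b \<notin> T \<union> I) \<le> 3"
    using assms(3) disj[of a] disj[of b]
    by (cases "a \<in> I"; cases "b \<in> I"; cases "a \<in> T"; cases "b \<in> T")
      (simp_all add: ab weight_def)
  then show ?thesis using loss by linarith
qed

lemma Isolator_gain:
  assumes "legal T I" "x \<in> E - (T \<union> I)" "nbrs x = {a, b}" "a \<noteq> b"
  shows "potential T (insert x I) = potential T I - weight T I x + bonus T I a + bonus T I b"
  using potential_Isolator[OF assms(1,2)] assms(3,4) by simp

lemma bonus_ge: "y \<notin> T \<Longrightarrow> 1 \<le> bonus T I y"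
  by (auto simp: bonus_def)

section \<open>Isolator's strategy: the lower bound\<close>

text \<open>
  The invariant when Isolator is to move, with target value \<open>X\<close>. In the second alternative his
  next move outweighs any reply of Toucher, which costs at most 4, by at least the missing 1.
\<close>

definition good :: "int \<Rightarrow> 'a set set \<Rightarrow> 'a set set \<Rightarrow> bool" where
  "good X T I \<longleftrightarrow> X \<le> potential T I \<or>
    X - 1 \<le> potential T I \<and>
    (\<exists>z \<in> E - (T \<union> I). potential T I + 5 \<le> potential T (insert z I))"

definition sound_move :: "int \<Rightarrow> 'a set set \<Rightarrow> 'a set set \<Rightarrow> 'a set \<Rightarrow> bool" where
  "sound_move X T I x \<longleftrightarrow> x \<in> E - (T \<union> I) \<and> X \<le> potential T (insert x I) \<and>
    (\<forall>y \<in> E - (T \<union> insert x I). good X (insert y T) (insert x I))"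

text \<open>
  Every edge that Isolator could extend is already blocked on the far side. In such a position
  Toucher, if she were to move, could destroy no more than 3, so Isolator wants to leave one
  behind whenever he gains only 3 himself.
\<close>

definition quiet :: "'a set set \<Rightarrow> 'a set set \<Rightarrow> bool" where
  "quiet T I \<longleftrightarrow> (\<forall>x \<in> E - (T \<union> I). nbrs x \<inter> I = {} \<or> nbrs x \<inter> T \<noteq> {})"

lemma sound_move_gain_4:
  assumes "x \<in> E - (T \<union> I)" "X + 4 \<le> potential T (insert x I)"
  shows "sound_move X T I x"
  unfolding sound_move_def good_def
  using assms Toucher_loss_le_4[of _ T "insert x I"] by fastforce

lemma sound_move_gain_3:
  assumes "legal T I" "x \<in> E - (T \<union> I)" "X + 3 \<le> potential T (insert x I)"
    "quiet T (insert x I)"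
  shows "sound_move X T I x"
proof -
  have "legal T (insert x I)" using assms by (auto simp: legal_def)
  then show ?thesis
    unfolding sound_move_def good_def
    using assms Toucher_loss_le_3[of T "insert x I"] by (fastforce simp: quiet_def)
qed

text \<open>
  Claiming an edge between two edges of Isolator gains 8. Extending an edge of his towards an
  unclaimed edge isolates a vertex, and the next edge gains in weight, which makes at least 4.
\<close>

lemma sound_move_not_quiet:
  assumes "legal T I" "X \<le> potential T I" "\<not> quiet T I"
  shows "\<exists>x. sound_move X T I x"
proof -
  obtain x where x: "x \<in> E - (T \<union> I)" "nbrs x \<inter> I \<noteq> {}" "nbrs x \<inter> T = {}"
    using assms(3) by (auto simp: quiet_def)
  then obtain a where a: "a \<in> nbrs x" "a \<in> I" by blast
  then obtain b where b: "b \<noteq> a" "nbrs x = {a, b}" using other_nbr[of x a] x(1) by blast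
  have "bonus T I a = 6" using a by (simp add: bonus_def)
  moreover have "weight T I x = (if b \<in> I then 4 else 3)"
    using a b by (auto simp: weight_def)
  moreover have "1 \<le> bonus T I b" "b \<in> I \<Longrightarrow> bonus T I b = 6"
    using x(3) b bonus_ge by (auto simp: bonus_def)
  ultimately have "X + 4 \<le> potential T (insert x I)"
    using assms Isolator_gain[OF assms(1) x(1) b(2)] b(1) by (auto split: if_splits)
  then show ?thesis using sound_move_gain_4 x(1) by blast
qed

text \<open>
  A new threat arises only at a neighbour of the claimed edge, and Toucher already blocks it if
  that neighbour lies beside one of her edges.
\<close>

lemma quiet_insert_Isolator:
  assumes "quiet T I" "\<And>y. y \<in> nbrs x \<Longrightarrow> y \<notin> T \<union> I \<Longrightarrow> nbrs y \<inter> T \<noteq> {}"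
  shows "quiet T (insert x I)"
  unfolding quiet_def
proof
  fix y assume y: "y \<in> E - (T \<union> insert x I)"
  show "nbrs y \<inter> insert x I = {} \<or> nbrs y \<inter> T \<noteq> {}"
  proof (cases "x \<in> nbrs y")
    case True
    then have "y \<in> nbrs x" using y nbrs_sym by blast
    then show ?thesis using assms(2) y by blast
  next
    case False
    then show ?thesis using assms(1) y by (auto simp: quiet_def)
  qed
qed

text \<open>
  In a quiet position an unclaimed edge beside an edge of Isolator has its other neighbour with
  Toucher. Claiming it isolates one vertex, for a net gain of 3, and creates no further threat.
\<close>

lemma sound_move_contested:
  assumes "legal T I" "X \<le> potential T I" "quiet T I"
    and x: "x \<in> E - (T \<union> I)" "nbrs x \<inter> I \<noteq> {}"
  shows "sound_move X T I x"
proof -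
  obtain a where a: "a \<in> nbrs x" "a \<in> I" using x by blast
  then obtain b where b: "b \<noteq> a" "nbrs x = {a, b}" using other_nbr[of x a] x(1) by blast
  have "nbrs x \<inter> T \<noteq> {}" using x assms(3) by (auto simp: quiet_def)
  then have bT: "b \<in> T" using a b assms(1) by (auto simp: legal_def)
  then have bI: "b \<notin> I" using assms(1) by (auto simp: legal_def)
  have "X + 3 \<le> potential T (insert x I)"
    using assms(2) Isolator_gain[OF assms(1) x(1) b(2)] a bT bI b
    by (auto simp: weight_def bonus_def)
  moreover have "quiet T (insert x I)"
    using assms(3) a b bT by (intro quiet_insert_Isolator) auto
  ultimately show ?thesis using sound_move_gain_3 assms x by blast
qed

text \<open>
  Here Toucher owns the edge beyond \<open>w\<close>, and Isolator claims the edge \<open>x\<close> after \<open>w\<close>, raising the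
  weight of \<open>w\<close> from 0 to 3. If Toucher also owns the other neighbour \<open>z\<close> of \<open>x\<close>, the gain is 3 and the
  position stays quiet; otherwise the increase of the weight of \<open>z\<close>, less the weight 1 of \<open>x\<close>, brings
  the gain to at least 4.
\<close>

lemma sound_move_beside_blocked:
  assumes "legal T I" "X \<le> potential T I" "quiet T I"
    and w: "w \<in> E - (T \<union> I)" "nbrs w \<inter> T \<noteq> {}" "nbrs w \<inter> I = {}"
    and x: "x \<in> nbrs w" "x \<notin> T \<union> I"
  shows "sound_move X T I x"
proof -
  have xF: "x \<in> E - (T \<union> I)" using x nbrsD(1)[OF x(1)] by blast
  have wx: "w \<in> nbrs x" using w x nbrs_sym by blast
  obtain z where z: "z \<noteq> w" "nbrs x = {w, z}" using other_nbr[of x w] xF wx by blast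
  have bw: "bonus T I w = 3" using w by (auto simp: bonus_def)
  have "nbrs x \<inter> I = {} \<or> nbrs x \<inter> T \<noteq> {}" using assms(3) xF by (simp add: quiet_def)
  then have zI: "z \<notin> I" using z(2) w(1) assms(1) by (auto simp: legal_def)
  show ?thesis
  proof (cases "z \<in> T")
    case True
    then have "X + 3 \<le> potential T (insert x I)"
      using assms(2) Isolator_gain[OF assms(1) xF z(2)] z bw zI w(1)
      by (auto simp: weight_def bonus_def)
    moreover have "quiet T (insert x I)"
      using assms(3) z True w by (intro quiet_insert_Isolator) auto
    ultimately show ?thesis using sound_move_gain_3 assms xF by blast
  next
    case False
    have "z \<in> E" "x \<in> nbrs z" using z xF nbrs_sym nbrsD(1)[of z x] by auto
    then obtain c where c: "c \<noteq> x" "nbrs z = {x, c}" using other_nbr[of z x] by blast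
    have "nbrs z \<inter> I = {}"
    proof (rule ccontr)
      assume "nbrs z \<inter> I \<noteq> {}"
      then have "nbrs z \<inter> T \<noteq> {}" using assms(3) \<open>z \<in> E\<close> False zI by (auto simp: quiet_def)
      then show False using \<open>nbrs z \<inter> I \<noteq> {}\<close> c xF assms(1) by (auto simp: legal_def)
    qed
    then have "2 \<le> bonus T I z" using False zI by (auto simp: bonus_def)
    moreover have "weight T I x = 1" using z w zI False by (auto simp: weight_def)
    ultimately have "X + 4 \<le> potential T (insert x I)"
      using assms(2) Isolator_gain[OF assms(1) xF z(2)] z bw by simp
    then show ?thesis using sound_move_gain_4 xF by blast
  qed
qed

text \<open>
  Every unclaimed edge belongs to a wholly unclaimed cycle or is enclosed by edges of Toucher.
  Opening a cycle gains 3, and Toucher can take back 4 only by claiming a neighbour \<open>y\<close> of \<open>x\<close> on a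
  cycle other than a triangle. Then the opposite neighbour \<open>z\<close> is unclaimed, and the edge \<open>c\<close>
  after it is unclaimed with no neighbour owned by Isolator, so that claiming \<open>z\<close> would gain at
  least \<open>6 - 3 + 2\<close>.
\<close>

lemma sound_move_fresh:
  assumes "legal T I" "X \<le> potential T I"
    and all_fresh: "\<And>e. e \<in> E - (T \<union> I) \<Longrightarrow> nbrs e \<subseteq> T \<or> fresh T I e"
    and x: "x \<in> E" "fresh T I x"
  shows "sound_move X T I x"
proof -
  have xF: "x \<in> E - (T \<union> I)" using x by (auto simp: fresh_def)
  have fresh_nbr: "fresh T I f" if "e \<in> E" "fresh T I e" "f \<in> nbrs e" for e f
  proof -
    have "f \<in> E - (T \<union> I)" "e \<in> nbrs f" "e \<notin> T"
      using that nbrsD(1)[OF that(3)] nbrs_sym by (auto simp: fresh_def)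
    then show ?thesis using all_fresh by blast
  qed
  have gain: "potential T (insert x I) = potential T I + 3"
  proof -
    obtain a b where ab: "a \<noteq> b" "nbrs x = {a, b}" using nbrs_pair[OF x(1)] by blast
    then have "fresh T I a" "fresh T I b" using fresh_nbr x by auto
    then have "bonus T I a = 2" "bonus T I b = 2" by (auto simp: bonus_def fresh_def)
    moreover have "weight T I x = 1" using ab x by (auto simp: weight_def fresh_def)
    ultimately show ?thesis using Isolator_gain[OF assms(1) xF ab(2,1)] by simp
  qed
  have legal': "legal T (insert x I)" using assms(1) xF by (auto simp: legal_def)
  have "good X (insert y T) (insert x I)" if y: "y \<in> E - (T \<union> insert x I)" for y
  proof (cases "nbrs y \<subseteq> T \<or> y \<notin> nbrs x")
    case True
    have "nbrs y \<inter> insert x I = {}"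
      using True
    proof
      assume "nbrs y \<subseteq> T"
      then show ?thesis using legal' by (auto simp: legal_def)
    next
      assume "y \<notin> nbrs x"
      then have "x \<notin> nbrs y" using y nbrs_sym by blast
      moreover have "nbrs y \<inter> I = {}"
        using all_fresh[of y] y assms(1) by (auto simp: fresh_def legal_def)
      ultimately show ?thesis by blast
    qed
    then have "potential T (insert x I) - 3 \<le> potential (insert y T) (insert x I)"
      using Toucher_loss_le_3[OF legal' y] by blast
    then show ?thesis using gain assms(2) by (simp add: good_def)
  next
    case False
    then have yx: "y \<in> nbrs x" by blast
    then obtain z where z: "z \<noteq> y" "nbrs x = {y, z}"
      using other_nbr[OF x(1)] by blast
    then have zE: "z \<in> E" "z \<noteq> x" "x \<in> nbrs z"
      using nbrsD[of z x] nbrs_sym[OF x(1), of z] by auto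
    obtain c where c: "c \<noteq> x" "nbrs z = {x, c}"
      using other_nbr[OF zE(1,3)] by blast
    then have cE: "c \<in> E" "c \<noteq> z" using nbrsD[of c z] by auto
    have fz: "fresh T I z" using fresh_nbr x z(2) by auto
    then have fc: "fresh T I c" using fresh_nbr zE(1) c(2) by auto
    show ?thesis
    \<comment> \<open>if \<open>c = y\<close>, the cycle is a triangle, and the loss is only 3 since \<open>z\<close> lies beside \<open>x\<close>\<close>
    proof (cases "c = y")
      case True
      have nb: "nbrs y = {x, z}"
      proof -
        have "x \<in> nbrs y" using nbrs_sym x(1) yx by blast
        moreover have "z \<in> nbrs y" using nbrs_sym[OF zE(1), of c] True c(2) by simp
        ultimately show ?thesis using other_nbr[of y x] y zE(2) by blast
      qed
      have "\<not> fresh T (insert x I) x" "\<not> fresh T (insert x I) z"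
        using zE(3) by (auto simp: fresh_def)
      then have "(\<Sum>e\<in>nbrs y. of_bool (fresh T (insert x I) e)) = (0 :: int)"
        using zE(2) by (simp add: nb del: sum_of_bool_eq)
      moreover have "weight T (insert x I) y = 3"
        using zE(2) fz nb by (simp add: weight_def fresh_def)
      ultimately show ?thesis
        using potential_Toucher[OF y] gain assms(2) by (simp add: good_def)
    next
      case False
      have legal'': "legal (insert y T) (insert x I)"
        using legal' y by (auto simp: legal_def)
      have zF: "z \<in> E - (insert y T \<union> insert x I)"
        using fz zE z(1) by (auto simp: fresh_def)
      have "c \<notin> nbrs x" using False cE(2) z(2) by blast
      then have "x \<notin> nbrs c" using nbrs_sym cE(1) by blast
      then have "2 \<le> bonus (insert y T) (insert x I) c"
        using fc False c(1) by (auto simp: bonus_def fresh_def)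
      moreover have "bonus (insert y T) (insert x I) x = 6" by (simp add: bonus_def)
      moreover have "weight (insert y T) (insert x I) z = 3"
        using c fc by (auto simp: weight_def fresh_def)
      ultimately have "potential (insert y T) (insert x I) + 5
          \<le> potential (insert y T) (insert z (insert x I))"
        using Isolator_gain[OF legal'' zF c(2)] c(1) by simp
      moreover have "X - 1 \<le> potential (insert y T) (insert x I)"
        using Toucher_loss_le_4[OF y] gain assms(2) by simp
      ultimately show ?thesis using zF unfolding good_def by blast
    qed
  qed
  then show ?thesis using xF gain assms(2) by (simp add: sound_move_def)
qed

text \<open>
  With every unclaimed edge enclosed by edges of Toucher nothing is at stake any more.
\<close>

lemma sound_move_exhausted:
  assumes "legal T I" "X \<le> potential T I"
    and exhausted: "\<And>e. e \<in> E - (T \<union> I) \<Longrightarrow> nbrs e \<subseteq> T"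
    and x: "x \<in> E - (T \<union> I)"
  shows "sound_move X T I x"
proof -
  have weight_0: "weight T J e = 0" if "e \<in> E" "nbrs e \<subseteq> T" "legal T J" for e J
    using nbrs_nonempty[OF that(1)] that by (auto simp: weight_def legal_def)
  have "(\<Sum>y\<in>nbrs x. bonus T I y) = 0"
    using exhausted[OF x] assms(1) by (intro sum.neutral) (auto simp: bonus_def legal_def)
  then have same: "potential T (insert x I) = potential T I"
    using potential_Isolator[OF assms(1) x] weight_0 exhausted[OF x] x assms(1) by simp
  have "potential (insert y T) (insert x I) = potential T I" if y: "y \<in> E - (T \<union> insert x I)" for y
  proof -
    have nb: "nbrs y \<subseteq> T" using exhausted y by blast
    then have "(\<Sum>e\<in>nbrs y. of_bool (fresh T (insert x I) e)) = (0 :: int)"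
      by (intro sum.neutral) (auto simp: fresh_def)
    moreover have "weight T (insert x I) y = 0"
      using nb y x assms(1) by (intro weight_0) (auto simp: legal_def)
    ultimately show ?thesis using potential_Toucher[OF y] same by simp
  qed
  then show ?thesis using x same assms(2) by (simp add: sound_move_def good_def)
qed

lemma sound_move_exists:
  assumes "legal T I" "good X T I" "E - (T \<union> I) \<noteq> {}"
  shows "\<exists>x. sound_move X T I x"
proof (cases "X \<le> potential T I")
  case False
  then obtain z where "z \<in> E - (T \<union> I)" "X - 1 \<le> potential T I"
    "potential T I + 5 \<le> potential T (insert z I)"
    using assms(2) by (auto simp: good_def)
  then show ?thesis using sound_move_gain_4[of z] by force
next
  case X: True
  show ?thesis
  proof (cases "quiet T I")
    case False
    then show ?thesis using sound_move_not_quiet assms(1) X by blast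
  next
    case quiet: True
    show ?thesis
    proof (cases "\<exists>x \<in> E - (T \<union> I). nbrs x \<inter> I \<noteq> {}")
      case True
      then show ?thesis using sound_move_contested assms(1) X quiet by blast
    next
      case no_I: False
      show ?thesis
      proof (cases "\<exists>w \<in> E - (T \<union> I). nbrs w \<inter> T \<noteq> {} \<and> \<not> nbrs w \<subseteq> T")
        case True
        then obtain w x where "w \<in> E - (T \<union> I)" "nbrs w \<inter> T \<noteq> {}" "x \<in> nbrs w" "x \<notin> T"
          by blast
        moreover from this have "nbrs w \<inter> I = {}" using no_I by blast
        ultimately show ?thesis
          using sound_move_beside_blocked[OF assms(1) X quiet, of w x] by blast
      next
        case False
        then have dichotomy: "nbrs e \<subseteq> T \<or> fresh T I e" if "e \<in> E - (T \<union> I)" for e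
          using no_I that by (auto simp: fresh_def)
        then show ?thesis
          using sound_move_fresh[OF assms(1) X] sound_move_exhausted[OF assms(1) X] assms(3)
          by blast
      qed
    qed
  qed
qed

lemma game_value_ge_of_good:
  assumes "legal T I" "good X T I"
  shows "X \<le> 6 * int (game_value V E Isolator T I)"
  using assms
proof (induction "card (E - (T \<union> I))" arbitrary: T I rule: less_induct)
  case less
  show ?case
  proof (cases "E \<subseteq> T \<union> I")
    case True
    then have "X \<le> potential T I" using less.prems by (auto simp: good_def)
    then show ?thesis
      using True less.prems by (simp add: game_value_final potential_final)
  next
    case False
    then obtain x where "sound_move X T I x" using sound_move_exists less.prems by blast
    then have x: "x \<in> E - (T \<union> I)" "X \<le> potential T (insert x I)"
      and replies: "\<And>y. y \<in> E - (T \<union> insert x I) \<Longrightarrow> good X (insert y T) (insert x I)"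
      by (auto simp: sound_move_def)
    have legal': "legal T (insert x I)" using less.prems x by (auto simp: legal_def)
    have "X \<le> 6 * int (game_value V E Toucher T (insert x I))"
    proof (cases "E \<subseteq> T \<union> insert x I")
      case True
      then show ?thesis using x legal' by (simp add: game_value_final potential_final)
    next
      case False
      then have "E - (T \<union> insert x I) \<noteq> {}" by blast
      then obtain y where y: "y \<in> E - (T \<union> insert x I)"
        and val: "game_value V E Toucher T (insert x I)
          = game_value V E Isolator (insert y T) (insert x I)"
        using game_value_Toucher_attained finite_E by metis
      have "card (E - (insert y T \<union> insert x I)) < card (E - (T \<union> I))"
        using x finite_E by (intro psubset_card_mono) auto
      moreover have "legal (insert y T) (insert x I)"
        using legal' y by (auto simp: legal_def)
      ultimately show ?thesis using less.hyps replies y val by simp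
    qed
    then show ?thesis
      using game_value_Isolator_ge[OF finite_E x(1), of V] by linarith
  qed
qed

theorem untouched_number_ge: "int (card V) - 3 \<le> 6 * int (untouched_number V E)"
proof (cases "E = {}")
  case True
  then show ?thesis using card_E_eq_card_V by simp
next
  case False
  have "legal {} {}" by (simp add: legal_def)
  obtain y where y: "y \<in> E"
    and val: "game_value V E Toucher {} {} = game_value V E Isolator {y} {}"
    using game_value_Toucher_attained[OF finite_E, of "{}" "{}"] False by auto
  have "int (card V) - 3 \<le> potential {y} {}"
    using Toucher_loss_le_3[OF \<open>legal {} {}\<close>, of y] y potential_initial by simp
  moreover have "legal {y} {}" using y by (simp add: legal_def)
  ultimately show ?thesis
    using game_value_ge_of_good[of "{y}" "{}"] val
    by (simp add: good_def untouched_number_def)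
qed

end

theorem theorem1p5:
  fixes V :: "'a set" and E :: "'a set set" and n :: nat
  assumes "regular_graph 2 V E" and "card V = n"
  shows "(real n - 3) / 6 \<le> real (untouched_number V E)
    \<and> real (untouched_number V E) \<le> real n / 4"
proof -
  interpret two_regular_graph V E by standard (rule assms(1))
  have "real (untouched_number V E) \<le> (\<Sum>v\<in>V. (1 / 2) ^ vertex_degree E v)"
    using finite_V finite_E by (rule untouched_number_le)
  also have "\<dots> = real n / 4"
    using assms by (simp add: regular_graph_def power2_eq_square)
  finally have upper: "real (untouched_number V E) \<le> real n / 4" .
  have "real n - 3 \<le> 6 * real (untouched_number V E)"
    using untouched_number_ge assms(2) by linarith
  with upper show ?thesis by simp
qed

end
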